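(* Let $(Q,\diamond,\triangleright)$ be a di-rack. Define a binary operation $\star:Q\times Q\rightarrow Q$ by $x\star y := x\diamond(x\triangleright y)$ for $x,y\in Q$. (i) Then $(Q,\star)$ is a rack, called the sub-adjacent rack of the di-rack $(Q,\diamond,\triangleright)$. Moreover, the triple $(Q,\diamond,\star)$ is a rack-pairing. (ii) The map $\Phi:Q\times Q\rightarrow Q$, $(x,y)\mapsto\Phi_xy = x\diamond(x\triangleright y)$ defines an action of the sub-adjacent rack $(Q,\star)$ on the rack $(Q,\diamond)$. Moreover, let $(Q,\diamond,\triangleright)$ and $(Q',\diamond',\triangleright')$ be two di-racks and let $\varphi:Q\rightarrow Q'$ be a morphism between them. Then $\varphi$ is a morphism between the corresponding sub-adjacent racks.
   Context: A (left) rack $(Q,\diamond)$ is a nonempty set $Q$ with a binary operation $\diamond$ such that $x\diamond(y\diamond z) = (x\diamond y)\diamond(x\diamond z)$ for all $x,y,z$, and for any $x,y$ there is a unique $c$ with $x\diamond c = y$. A di-rack $(Q,\diamond,\triangleright)$ is a rack $(Q,\diamond)$ with a binary operation $\triangleright$ such that: for each $x\in Q$ the map $x\triangleright -:Q\to Q$ is bijective and $x\triangleright(y\diamond z) = (x\triangleright y)\diamond(x\triangleright z)$ for all $x,y,z$; and $x\diamond(x\triangleright(y\triangleright z)) = (x\diamond(x\triangleright y))\triangleright(x\diamond(x\triangleright z))$ for all $x,y,z\in Q$. A morphism of di-racks is a map preserving both operations. A rack-pairing is a triple $(Q,\diamond,\star)$ such that $(Q,\diamond)$ and $(Q,\star)$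 are racks and $x\star(y\diamond z) = (x\star y)\diamond(x\star z)$ for all $x,y,z$. An action of a rack $(Q,\star)$ on a rack $(R,\diamond)$ is a map $\Phi:Q\times R\to R$, $(x,u)\mapsto\Phi_xu$, such that each $\Phi_x$ is a rack automorphism of $(R,\diamond)$ (a bijection preserving $\diamond$) and $\Phi_x\Phi_y = \Phi_{x\star y}\Phi_x$ for all $x,y\in Q$. *)

theory Defs
  imports Main
begin

text \<open>
  All structures live on an explicit carrier set; the operations are HOL functions whose values
  outside the carrier are irrelevant. All racks are left racks.
\<close>

locale rack =
  fixes Q :: "'a set" and op :: "'a \<Rightarrow> 'a \<Rightarrow> 'a" (infixl \<open>\<diamond>\<close> 70)
  assumes nonempty: "Q \<noteq> {}"
    and closed: "x \<in> Q \<Longrightarrow> y \<in> Q \<Longrightarrow> x \<diamond> y \<in> Q"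
    and self_distrib:
      "x \<in> Q \<Longrightarrow> y \<in> Q \<Longrightarrow> z \<in> Q \<Longrightarrow> x \<diamond> (y \<diamond> z) = (x \<diamond> y) \<diamond> (x \<diamond> z)"
    and left_div: "x \<in> Q \<Longrightarrow> y \<in> Q \<Longrightarrow> \<exists>!c\<in>Q. x \<diamond> c = y"

locale rack_hom =
  source: rack Q op + target: rack Q' op'
  for Q :: "'a set" and op (infixl \<open>\<diamond>\<close> 70)
    and Q' :: "'b set" and op' (infixl \<open>\<diamond>''\<close> 70) +
  fixes \<phi> :: "'a \<Rightarrow> 'b"
  assumes maps_to: "x \<in> Q \<Longrightarrow> \<phi> x \<in> Q'"
    and preserves: "x \<in> Q \<Longrightarrow> y \<in> Q \<Longrightarrow> \<phi> (x \<diamond> y) = \<phi> x \<diamond>' \<phi> y"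

definition rack_automorphism :: "'a set \<Rightarrow> ('a \<Rightarrow> 'a \<Rightarrow> 'a) \<Rightarrow> ('a \<Rightarrow> 'a) \<Rightarrow> bool" where
  "rack_automorphism R op f \<longleftrightarrow> rack_hom R op R op f \<and> bij_betw f R R"

locale di_rack = rack Q op
  for Q :: "'a set" and op (infixl \<open>\<diamond>\<close> 70) +
  fixes tri :: "'a \<Rightarrow> 'a \<Rightarrow> 'a" (infixl \<open>\<triangleright>\<close> 70)
  assumes tri_bij: "x \<in> Q \<Longrightarrow> bij_betw (\<lambda>y. x \<triangleright> y) Q Q"
    and tri_distrib:
      "x \<in> Q \<Longrightarrow> y \<in> Q \<Longrightarrow> z \<in> Q \<Longrightarrow> x \<triangleright> (y \<diamond> z) = (x \<triangleright> y) \<diamond> (x \<triangleright> z)"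
    and di_rack_identity:
      "x \<in> Q \<Longrightarrow> y \<in> Q \<Longrightarrow> z \<in> Q \<Longrightarrow>
        x \<diamond> (x \<triangleright> (y \<triangleright> z)) = (x \<diamond> (x \<triangleright> y)) \<triangleright> (x \<diamond> (x \<triangleright> z))"

locale di_rack_hom =
  source: di_rack Q op tri + target: di_rack Q' op' tri'
  for Q :: "'a set" and op (infixl \<open>\<diamond>\<close> 70) and tri (infixl \<open>\<triangleright>\<close> 70)
    and Q' :: "'b set" and op' (infixl \<open>\<diamond>''\<close> 70) and tri' (infixl \<open>\<triangleright>''\<close> 70) +
  fixes \<phi> :: "'a \<Rightarrow> 'b"
  assumes maps_to: "x \<in> Q \<Longrightarrow> \<phi> x \<in> Q'"
    and preserves_op: "x \<in> Q \<Longrightarrow> y \<in> Q \<Longrightarrow> \<phi> (x \<diamond> y) = \<phi> x \<diamond>' \<phi> y"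
    and preserves_tri: "x \<in> Q \<Longrightarrow> y \<in> Q \<Longrightarrow> \<phi> (x \<triangleright> y) = \<phi> x \<triangleright>' \<phi> y"

definition sub_adjacent ::
    "('a \<Rightarrow> 'a \<Rightarrow> 'a) \<Rightarrow> ('a \<Rightarrow> 'a \<Rightarrow> 'a) \<Rightarrow> 'a \<Rightarrow> 'a \<Rightarrow> 'a" where
  "sub_adjacent op tri x y = op x (tri x y)"

locale rack_pairing =
  base: rack Q op + star: rack Q star
  for Q :: "'a set" and op (infixl \<open>\<diamond>\<close> 70) and star (infixl \<open>\<star>\<close> 70) +
  assumes star_distrib:
    "x \<in> Q \<Longrightarrow> y \<in> Q \<Longrightarrow> z \<in> Q \<Longrightarrow> x \<star> (y \<diamond> z) = (x \<star> y) \<diamond> (x \<star> z)"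

text \<open>The rack \<open>(Q, \<star>)\<close> acts on the rack \<open>(R, \<diamond>)\<close>; \<open>\<Phi>\<close> is curried.\<close>

locale rack_action =
  acting: rack Q star + acted: rack R op
  for Q :: "'a set" and star (infixl \<open>\<star>\<close> 70)
    and R :: "'b set" and op (infixl \<open>\<diamond>\<close> 70) +
  fixes \<Phi> :: "'a \<Rightarrow> 'b \<Rightarrow> 'b"
  assumes automorphism: "x \<in> Q \<Longrightarrow> rack_automorphism R (\<diamond>) (\<Phi> x)"
    and action:
      "x \<in> Q \<Longrightarrow> y \<in> Q \<Longrightarrow> u \<in> R \<Longrightarrow> \<Phi> x (\<Phi> y u) = \<Phi> (x \<star> y) (\<Phi> x u)"

end

theory Submission imports Defs begin

text \<open>
  The left translation by \<open>x\<close> in the sub-adjacent operation is the composite of the two rack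
  automorphisms \<open>x \<triangleright> -\<close> and \<open>x \<diamond> -\<close>, so it preserves \<open>\<diamond>\<close>; the di-rack identity says precisely that
  it preserves \<open>\<triangleright>\<close> as well. Hence it preserves every operation built from these two, in particular
  the sub-adjacent operation itself.
\<close>

text \<open>Bridges the two forms of left divisibility: racks assume unique solvability on the
  carrier, while \<open>tri_bij\<close> speaks of \<open>bij_betw\<close>, the form in which
  translations can be composed.\<close>

lemma bij_betw_iff_ex1:
  "bij_betw f A B \<longleftrightarrow> (\<forall>x\<in>A. f x \<in> B) \<and> (\<forall>y\<in>B. \<exists>!x\<in>A. f x = y)"
proof
  assume bij: "bij_betw f A B"
  have "\<exists>!x\<in>A. f x = y" if "y \<in> B" for y
  proof -
    have "y \<in> f ` A"
      using bij that by (simp add: bij_betw_def)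
    then obtain x where "x \<in> A" "f x = y"
      by blast
    show ?thesis
    proof (rule ex1I)
      show "x \<in> A \<and> f x = y"
        using \<open>x \<in> A\<close> \<open>f x = y\<close> by simp
      show "x' = x" if "x' \<in> A \<and> f x' = y" for x'
        using inj_onD[OF bij_betw_imp_inj_on[OF bij], of x' x] that \<open>x \<in> A\<close> \<open>f x = y\<close>
        by simp
    qed
  qed
  then show "(\<forall>x\<in>A. f x \<in> B) \<and> (\<forall>y\<in>B. \<exists>!x\<in>A. f x = y)"
    by (intro conjI ballI bij_betw_apply[OF bij])
next
  assume unique: "(\<forall>x\<in>A. f x \<in> B) \<and> (\<forall>y\<in>B. \<exists>!x\<in>A. f x = y)"
  show "bij_betw f A B"
  proof (rule bij_betwI')
    show "f x = f y \<longleftrightarrow> x = y" if "x \<in> A" "y \<in> A" for x y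
    proof
      assume "f x = f y"
      moreover have "\<exists>!z. z \<in> A \<and> f z = f x"
        using unique that(1) by simp
      ultimately show "x = y"
        using that by (metis (no_types))
    qed simp
    show "f x \<in> B" if "x \<in> A" for x
      using unique that by simp
    show "\<exists>x\<in>A. y = f x" if "y \<in> B" for y
    proof -
      have "\<exists>x. x \<in> A \<and> f x = y"
        by (rule ex1_implies_ex) (use unique that in simp)
      then show ?thesis
        by blast
    qed
  qed
qed

lemma (in rack) left_bij: "x \<in> Q \<Longrightarrow> bij_betw (\<lambda>y. x \<diamond> y) Q Q"
  by (simp add: bij_betw_iff_ex1 closed left_div)

context di_rack
begin

abbreviation star (infixl \<open>\<star>\<close> 70)
  where "x \<star> y \<equiv> sub_adjacent (\<diamond>) (\<triangleright>) x y"

lemma tri_closed: "x \<in> Q \<Longrightarrow> y \<in> Q \<Longrightarrow> x \<triangleright> y \<in> Q"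
  using tri_bij bij_betwE by blast

lemma star_closed: "x \<in> Q \<Longrightarrow> y \<in> Q \<Longrightarrow> x \<star> y \<in> Q"
  by (simp add: sub_adjacent_def closed tri_closed)

lemma star_bij: "x \<in> Q \<Longrightarrow> bij_betw (\<lambda>y. x \<star> y) Q Q"
  using bij_betw_trans[OF tri_bij left_bij] by (simp add: sub_adjacent_def comp_def)

lemma star_op_distrib:
  "x \<in> Q \<Longrightarrow> y \<in> Q \<Longrightarrow> z \<in> Q \<Longrightarrow> x \<star> (y \<diamond> z) = (x \<star> y) \<diamond> (x \<star> z)"
  \<comment> \<open>\<open>self_distrib\<close> is instantiated because its right-hand side matches
    its own left-hand side again, so the general equation would loop as a rewrite rule.\<close>
  by (simp only: sub_adjacent_def tri_distrib self_distrib[of x "x \<triangleright> y" "x \<triangleright> z"] tri_closed)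

lemma star_tri_distrib:
  "x \<in> Q \<Longrightarrow> y \<in> Q \<Longrightarrow> z \<in> Q \<Longrightarrow> x \<star> (y \<triangleright> z) = (x \<star> y) \<triangleright> (x \<star> z)"
  by (simp add: sub_adjacent_def di_rack_identity)

lemma star_self_distrib:
  assumes "x \<in> Q" "y \<in> Q" "z \<in> Q"
  shows "x \<star> (y \<star> z) = (x \<star> y) \<star> (x \<star> z)"
proof -
  \<comment> \<open>Only the inner product is unfolded, to
    \<open>y \<diamond> (y \<triangleright> z)\<close>; the outer translation by \<open>x\<close>
    stays folded and distributes over \<open>\<diamond>\<close>.\<close>
  have "x \<star> (y \<star> z) = (x \<star> y) \<diamond> (x \<star> (y \<triangleright> z))"
    using assms by (simp add: star_op_distrib tri_closed sub_adjacent_def[of _ _ y])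
  then show ?thesis
    \<comment> \<open>Distributing over \<open>\<triangleright>\<close> leaves \<open>(x \<star> y)
      \<diamond> ((x \<star> y) \<triangleright> (x \<star> z))\<close>, which is the definition of
      \<open>\<star>\<close> at \<open>x \<star> y\<close>.\<close>
    using assms by (simp add: star_tri_distrib sub_adjacent_def[of _ _ "x \<star> y"])
qed

lemma rack_star: "rack Q (\<star>)"
proof (rule rack.intro)
  show "\<exists>!c\<in>Q. x \<star> c = y" if "x \<in> Q" "y \<in> Q" for x y
    using star_bij[OF that(1)] that(2) by (simp add: bij_betw_iff_ex1)
  show "x \<star> (y \<star> z) = (x \<star> y) \<star> (x \<star> z)" if "x \<in> Q" "y \<in> Q" "z \<in> Q" for x y z
    using that by (rule star_self_distrib)
qed (simp_all add: nonempty star_closed)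

lemma rack_pairing_star: "rack_pairing Q (\<diamond>) (\<star>)"
  by (intro rack_pairing.intro rack_pairing_axioms.intro rack_axioms rack_star star_op_distrib)

lemma star_automorphism: "x \<in> Q \<Longrightarrow> rack_automorphism Q (\<diamond>) (\<lambda>y. x \<star> y)"
  by (simp add: rack_automorphism_def rack_hom_def rack_hom_axioms_def rack_axioms
      star_closed star_op_distrib star_bij)

text \<open>For the action by left translations, the law
  \<open>\<Phi> x (\<Phi> y u) = \<Phi> (x \<star> y) (\<Phi> x u)\<close> is exactly
  self-distributivity of \<open>\<star>\<close>.\<close>

lemma rack_action_star: "rack_action Q (\<star>) Q (\<diamond>) (\<star>)"
  by (intro rack_action.intro rack_action_axioms.intro rack_axioms rack_star
      star_automorphism star_self_distrib)

end

text \<open>Since \<open>\<star>\<close> is a term in \<open>\<diamond>\<close> and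
  \<open>\<triangleright>\<close>, a map preserving both preserves it; closure under
  \<open>\<triangleright>\<close> lets \<open>preserves_op\<close> apply to
  \<open>x \<diamond> (x \<triangleright> y)\<close>.\<close>

lemma (in di_rack_hom) rack_hom_star:
  "rack_hom Q (sub_adjacent (\<diamond>) (\<triangleright>)) Q' (sub_adjacent (\<diamond>') (\<triangleright>')) \<phi>"
  by (simp add: rack_hom_def rack_hom_axioms_def source.rack_star target.rack_star maps_to
      sub_adjacent_def preserves_op preserves_tri source.tri_closed)

theorem proposition4p30:
  fixes Q :: "'a set" and op tri :: "'a \<Rightarrow> 'a \<Rightarrow> 'a"
  assumes "di_rack Q op tri"
  shows "rack Q (sub_adjacent op tri)
    \<and> rack_pairing Q op (sub_adjacent op tri)
    \<and> rack_action Q (sub_adjacent op tri) Q op (\<lambda>x y. op x (tri x y))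
    \<and> (\<forall>(Q' :: 'b set) op' tri' \<phi>.
         di_rack Q' op' tri' \<longrightarrow> di_rack_hom Q op tri Q' op' tri' \<phi> \<longrightarrow>
         rack_hom Q (sub_adjacent op tri) Q' (sub_adjacent op' tri') \<phi>)"
proof -
  \<comment> \<open>An equation between functions is needed, as \<open>rack_action\<close> takes the
    unapplied map and the goal spells it out as a lambda term.\<close>
  have "sub_adjacent op tri = (\<lambda>x y. op x (tri x y))"
    by (intro ext) (rule sub_adjacent_def)
  then have "rack_action Q (sub_adjacent op tri) Q op (\<lambda>x y. op x (tri x y))"
    using di_rack.rack_action_star[OF assms] by simp
  then show ?thesis
    using di_rack.rack_star[OF assms] di_rack.rack_pairing_star[OF assms]
    by (auto intro: di_rack_hom.rack_hom_star)
qed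

end
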